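(* Let $z\in\mathbb{C}$ with $0<|z|<1$, $-\pi<\arg z<\pi$, and $z\notin(0,1)$. Let $\ln z$ be the principal logarithm, $\varphi=\arg(-\ln z)$, and $z^{-a}=e^{-a\ln z}$. Let $n\in\{1,2,\ldots\}$ and $a\in\mathbb{C}\setminus\mathbb{Z}$. Then $$\Phi(z,n,a)+(-1)^n z^{-1}\,\Phi(z^{-1},n,1-a)=\frac{\pi(-1)^{n-1}}{(n-1)!}\,\frac{\partial^{n-1}}{\partial a^{n-1}}\Big(z^{-a}\big(\cot(\pi a)-\operatorname{sgn}(\varphi)\,i\big)\Big).$$
   Context: The Lerch transcendent is defined by $\Phi(z,s,a)=\sum_{m=0}^{\infty}\frac{z^m}{(a+m)^s}$ for $|z|<1$, $a\neq 0,-1,-2,\ldots$, and elsewhere by analytic continuation. In particular, for $w\in\mathbb{C}\setminus[1,\infty)$, $\Re s>0$, $\Re b>0$, one has $\Phi(w,s,b)=\frac{1}{\Gamma(s)}\int_0^\infty\frac{t^{s-1}e^{-bt}}{1-we^{-t}}\,dt$, and for fixed such $w$ and positive integer $n$, $\Phi(w,n,b)$ is continued to a meromorphic function of $b\in\mathbb{C}$ with poles only at $b=0,-1,-2,\ldots$; this is the meaning of $\Phi(z^{-1},n,1-a)$ here. $\operatorname{sgn}$ is the sign function (note $\varphi\neq0$ under the hypotheses). *)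

theory Defs
  imports "HOL-Complex_Analysis.Complex_Analysis"
begin

definition lerch_series :: "complex \<Rightarrow> complex \<Rightarrow> complex \<Rightarrow> complex" where
  "lerch_series z s a = (\<Sum>m. z ^ m / (a + of_nat m) powr s)"

definition lerch_integral :: "complex \<Rightarrow> complex \<Rightarrow> complex \<Rightarrow> complex" where
  "lerch_integral w s b =
     1 / Gamma s *
     integral {0<..} (\<lambda>t::real. of_real t powr (s - 1) * exp (- b * of_real t) /
                                (1 - w * exp (- of_real t)))"

definition lerch_continuation :: "complex \<Rightarrow> nat \<Rightarrow> (complex \<Rightarrow> complex) \<Rightarrow> bool" where
  "lerch_continuation w n F \<longleftrightarrow>
     F meromorphic_on UNIV \<and> F holomorphic_on (- \<int>\<^sub>\<le>\<^sub>0) \<and>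
     (\<forall>b. Re b > 0 \<longrightarrow> F b = lerch_integral w (of_nat n) b)"

text \<open>The Lerch transcendent at a positive integer order. In the second branch, for
  \<open>w\<close> off the cut \<open>[1, \<infinity>)\<close>, the continuation is determined on the connected set
  \<open>- \<int>\<^sub>\<le>\<^sub>0\<close> by the identity theorem; only its values at the poles depend on the choice.
  The value for \<open>w\<close> on the cut is not meaningful.\<close>

definition lerch_phi :: "complex \<Rightarrow> nat \<Rightarrow> complex \<Rightarrow> complex" where
  "lerch_phi w n b =
     (if norm w < 1 then lerch_series w (of_nat n) b
      else (SOME F. lerch_continuation w n F) b)"

end

theory Submission
  imports Defs
begin

text \<open>
  Expanding one term of the geometric series in the integral for \<open>Re b > 0\<close> gives
  \<open>\<Phi>(w, n, b) = 1 / b^n + w \<Phi>(w, n, b + 1)\<close>, which continues \<open>\<Phi>(w, n, b)\<close> step by step to the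
  left in \<open>b\<close>. Since \<open>\<partial>\<Phi>(w, n, b)/\<partial>b = - n \<Phi>(w, n + 1, b)\<close>, the reflection formula at order \<open>n\<close>
  follows from the one at order 1 by differentiating \<open>n - 1\<close> times.

  For order 1 write \<open>z = - exp c\<close> with \<open>\<bar>Im c\<bar> < pi\<close>. If \<open>Re b > 0\<close>, the product
  \<open>exp (b c) \<Phi>(- exp c, 1, b)\<close> is the integral of \<open>exp (b x) / (1 + exp x)\<close> over the left ray ending
  in \<open>c\<close>, so its derivative in \<open>c\<close> is \<open>exp (b c) / (1 + exp c)\<close>; the recursion in \<open>b\<close> carries this
  over to all \<open>b\<close>. Hence
  \<open>exp (a c) \<Phi>(- exp c, 1, a) + exp (- (1 - a) c) \<Phi>(- exp (- c), 1, 1 - a)\<close> does not depend on \<open>c\<close>.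
  At \<open>c = 0\<close> it is \<open>\<Sum>m. (-1)^m (1 / (a + m) + 1 / (1 - a + m)) = pi / sin (pi a)\<close>, by the
  reflection formula of the digamma function.
\<close>

subsection \<open>Integrals depending on a parameter\<close>

lemma set_integrable_dominated:
  fixes f :: "'a \<Rightarrow> 'b :: {banach, second_countable_topology}"
  assumes "set_integrable M A g" "set_borel_measurable M A f"
    and "\<And>t. t \<in> A \<Longrightarrow> norm (f t) \<le> g t"
  shows "set_integrable M A f"
  using assms(1,2)
proof (rule set_integrable_bound)
  show "AE t in M. t \<in> A \<longrightarrow> norm (f t) \<le> norm (g t)"
    using assms(3) order_trans[OF _ abs_ge_self] by (intro always_eventually) auto
qed

lemma set_integral_dominated_convergence:
  fixes s :: "nat \<Rightarrow> 'a \<Rightarrow> 'b :: {banach, second_countable_topology}"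
  assumes meas: "\<And>i. set_borel_measurable M A (s i)"
    and bound: "\<And>i t. t \<in> A \<Longrightarrow> norm (s i t) \<le> g t"
    and lim: "\<And>t. t \<in> A \<Longrightarrow> (\<lambda>i. s i t) \<longlonglongrightarrow> f t"
    and g: "set_integrable M A g"
  shows "set_integrable M A f"
    and "(\<lambda>i. LINT t:A|M. s i t) \<longlonglongrightarrow> (LINT t:A|M. f t)"
proof -
  have s_meas: "(\<lambda>t. indicator A t *\<^sub>R s i t) \<in> borel_measurable M" for i
    using meas by (simp add: set_borel_measurable_def)
  have lim_all: "(\<lambda>i. indicator A t *\<^sub>R s i t) \<longlonglongrightarrow> indicator A t *\<^sub>R f t" for t
    using lim by (auto simp: indicator_def)
  have f_meas: "(\<lambda>t. indicator A t *\<^sub>R f t) \<in> borel_measurable M"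
    using s_meas lim_all by (rule borel_measurable_LIMSEQ_metric)
  have lim_AE: "AE t in M. (\<lambda>i. indicator A t *\<^sub>R s i t) \<longlonglongrightarrow> indicator A t *\<^sub>R f t"
    using lim_all by simp
  have bound_AE: "AE t in M. norm (indicator A t *\<^sub>R s i t) \<le> indicator A t *\<^sub>R g t" for i
    using bound by (intro always_eventually) (auto simp: indicator_def)
  have g_int: "integrable M (\<lambda>t. indicator A t *\<^sub>R g t)"
    using g by (simp add: set_integrable_def)
  show "set_integrable M A f"
    unfolding set_integrable_def
    by (rule integrable_dominated_convergence[OF f_meas s_meas g_int lim_AE bound_AE])
  show "(\<lambda>i. LINT t:A|M. s i t) \<longlonglongrightarrow> (LINT t:A|M. f t)"
    unfolding set_lebesgue_integral_def
    by (rule integral_dominated_convergence[OF f_meas s_meas g_int lim_AE bound_AE])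
qed

lemma holomorphic_bounded_imp_Lipschitz:
  assumes holo: "f holomorphic_on ball x (2 * r)"
    and bound: "\<And>y. y \<in> ball x (2 * r) \<Longrightarrow> norm (f y) \<le> B"
    and y: "y \<in> ball x r"
  shows "norm (f y - f x) \<le> B / r * norm (y - x)"
proof (rule field_differentiable_bound[OF convex_ball])
  have r: "r > 0"
    using y le_less_trans[OF zero_le_dist, of x y r] by simp
  fix u assume u: "u \<in> ball x r"
  have sub: "cball u r \<subseteq> ball x (2 * r)"
  proof
    fix v assume "v \<in> cball u r"
    thus "v \<in> ball x (2 * r)" using u dist_triangle[of x v u] by simp
  qed
  have holo_u: "f holomorphic_on cball u r"
    using holo sub by (rule holomorphic_on_subset)
  have "norm ((deriv ^^ 1) f u) \<le> fact 1 * B / r ^ 1"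
  proof (rule Cauchy_inequality[OF _ _ r])
    show "f holomorphic_on ball u r" "continuous_on (cball u r) f"
      using holo_u by (auto intro: holomorphic_on_subset holomorphic_on_imp_continuous_on)
    show "norm (f v) \<le> B" if "norm (u - v) = r" for v
      using that sub by (intro bound) (auto simp: dist_norm subset_iff)
  qed
  thus "norm (deriv f u) \<le> B / r" by simp
  have "u \<in> ball x (2 * r)" using u r by auto
  thus "(f has_field_derivative deriv f u) (at u within ball x r)"
    using holomorphic_derivI[OF holo open_ball] has_field_derivative_at_within by blast
qed (use y le_less_trans[OF zero_le_dist, of x y r] in auto)

lemma set_integral_difference_quotient_tendsto:
  fixes f :: "complex \<Rightarrow> 'a \<Rightarrow> complex"
  assumes meas: "\<And>y. y \<in> ball x (2 * r) \<Longrightarrow> set_borel_measurable M A (f y)"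
    and holo: "\<And>t. t \<in> A \<Longrightarrow> (\<lambda>y. f y t) holomorphic_on ball x (2 * r)"
    and bound: "\<And>y t. y \<in> ball x (2 * r) \<Longrightarrow> t \<in> A \<Longrightarrow> norm (f y t) \<le> g t"
    and g: "set_integrable M A g"
    and X: "\<And>i. X i \<in> ball x r - {x}" "X \<longlonglongrightarrow> x"
  shows "set_integrable M A (\<lambda>t. deriv (\<lambda>y. f y t) x)"
    and "(\<lambda>i. LINT t:A|M. (f (X i) t - f x t) / (X i - x))
           \<longlonglongrightarrow> (LINT t:A|M. deriv (\<lambda>y. f y t) x)"
proof -
  have r: "r > 0"
    using X(1)[of 0] le_less_trans[OF zero_le_dist, of x "X 0" r] by simp
  have X_in: "X i \<in> ball x (2 * r)" for i
    using X(1)[of i] r by simp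
  have int: "set_integrable M A (f y)" if "y \<in> ball x (2 * r)" for y
    using g meas[OF that] bound[OF that] by (rule set_integrable_dominated)
  have "set_integrable M A (\<lambda>t. (f (X i) t - f x t) / (X i - x))" for i
    using r X_in by (intro set_integrable_divide set_integral_diff int) auto
  hence meas_quot: "set_borel_measurable M A (\<lambda>t. (f (X i) t - f x t) / (X i - x))" for i
    using borel_measurable_integrable by (auto simp: set_borel_measurable_def set_integrable_def)
  have bound_quot: "norm ((f (X i) t - f x t) / (X i - x)) \<le> g t / r" if "t \<in> A" for i t
  proof -
    have "norm (f (X i) t - f x t) \<le> g t / r * norm (X i - x)"
      using holo[OF that] bound[OF _ that] X(1)[of i]
      by (intro holomorphic_bounded_imp_Lipschitz[where f = "\<lambda>y. f y t"]) auto
    thus ?thesis using X(1)[of i] by (simp add: norm_divide pos_divide_le_eq)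
  qed
  have lim_quot: "(\<lambda>i. (f (X i) t - f x t) / (X i - x)) \<longlonglongrightarrow> deriv (\<lambda>y. f y t) x"
    if "t \<in> A" for t
  proof -
    have "((\<lambda>y. (f y t - f x t) / (y - x)) \<longlongrightarrow> deriv (\<lambda>y. f y t) x) (at x)"
      using holomorphic_derivI[OF holo[OF that] open_ball, of x] r
      by (simp add: has_field_derivative_iff)
    moreover have "filterlim X (at x) sequentially"
      using X by (auto simp: filterlim_at)
    ultimately show ?thesis by (rule filterlim_compose)
  qed
  have g_quot: "set_integrable M A (\<lambda>t. g t / r)" using g by simp
  show "set_integrable M A (\<lambda>t. deriv (\<lambda>y. f y t) x)"
    by (rule set_integral_dominated_convergence[OF meas_quot bound_quot lim_quot g_quot])
  show "(\<lambda>i. LINT t:A|M. (f (X i) t - f x t) / (X i - x))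
          \<longlonglongrightarrow> (LINT t:A|M. deriv (\<lambda>y. f y t) x)"
    by (rule set_integral_dominated_convergence[OF meas_quot bound_quot lim_quot g_quot])
qed

lemma has_field_derivative_set_lebesgue_integral:
  fixes f :: "complex \<Rightarrow> 'a \<Rightarrow> complex"
  assumes S: "open S" "x \<in> S"
    and meas: "\<And>y. y \<in> S \<Longrightarrow> set_borel_measurable M A (f y)"
    and holo: "\<And>t. t \<in> A \<Longrightarrow> (\<lambda>y. f y t) holomorphic_on S"
    and bound: "\<And>y t. y \<in> S \<Longrightarrow> t \<in> A \<Longrightarrow> norm (f y t) \<le> g t"
    and g: "set_integrable M A g"
  shows "set_integrable M A (\<lambda>t. deriv (\<lambda>y. f y t) x)"
    and "((\<lambda>y. LINT t:A|M. f y t) has_field_derivative (LINT t:A|M. deriv (\<lambda>y. f y t) x)) (at x)"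
proof -
  obtain r where r: "r > 0" "ball x (2 * r) \<subseteq> S"
  proof -
    obtain e where "e > 0" "ball x e \<subseteq> S" using S open_contains_ball by blast
    thus thesis by (intro that[of "e / 2"]) auto
  qed
  have int: "set_integrable M A (f y)" if "y \<in> S" for y
    using g meas[OF that] bound[OF that] by (rule set_integrable_dominated)
  have quot: "set_integrable M A (\<lambda>t. deriv (\<lambda>y. f y t) x) \<and>
      (\<lambda>i. LINT t:A|M. (f (X i) t - f x t) / (X i - x)) \<longlonglongrightarrow> (LINT t:A|M. deriv (\<lambda>y. f y t) x)"
    if "\<And>i. X i \<in> ball x r - {x}" "X \<longlonglongrightarrow> x" for X
    using that r(2)
    by (intro conjI; intro set_integral_difference_quotient_tendsto[where r = r and g = g] g)
       (auto intro: meas bound holomorphic_on_subset[OF holo])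
  have "((\<lambda>y. LINT t:A|M. (f y t - f x t) / (y - x)) \<longlongrightarrow> (LINT t:A|M. deriv (\<lambda>y. f y t) x))
          (at x within ball x r)"
    unfolding tendsto_at_iff_sequentially using quot by (auto simp: o_def)
  moreover have "\<forall>\<^sub>F y in at x within ball x r. (LINT t:A|M. (f y t - f x t) / (y - x)) =
      ((LINT t:A|M. f y t) - (LINT t:A|M. f x t)) / (y - x)"
    unfolding eventually_at_filter
  proof (intro always_eventually allI impI)
    fix y assume "y \<in> ball x r"
    hence "y \<in> S" using r by (auto simp: subset_iff)
    thus "(LINT t:A|M. (f y t - f x t) / (y - x)) =
        ((LINT t:A|M. f y t) - (LINT t:A|M. f x t)) / (y - x)"
      using S by (simp add: int)
  qed
  ultimately have "((\<lambda>y. LINT t:A|M. f y t) has_field_derivative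
      (LINT t:A|M. deriv (\<lambda>y. f y t) x)) (at x within ball x r)"
    unfolding has_field_derivative_iff by (rule Lim_transform_eventually)
  thus "((\<lambda>y. LINT t:A|M. f y t) has_field_derivative (LINT t:A|M. deriv (\<lambda>y. f y t) x)) (at x)"
    using r(1) by (simp add: at_within_open[of x "ball x r"])
  have "x islimpt ball x r - {x}"
    using r(1) by (simp add: islimpt_ball islimpt_punctured[symmetric])
  then obtain X where "\<And>i. X i \<in> ball x r - {x}" "X \<longlonglongrightarrow> x"
    by (auto simp: islimpt_sequential)
  thus "set_integrable M A (\<lambda>t. deriv (\<lambda>y. f y t) x)"
    using quot by blast
qed

lemma set_integral_greaterThan_FTC:
  fixes F f :: "real \<Rightarrow> 'a :: euclidean_space"
  assumes "\<And>t. t > a \<Longrightarrow> (F has_vector_derivative f t) (at t)"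
    and cont: "\<And>t. t > a \<Longrightarrow> isCont f t" "isCont F a"
    and "set_integrable lborel {a<..} f"
    and lim: "(F \<longlongrightarrow> L) at_top"
  shows "(LINT t:{a<..}|lborel. f t) = L - F a"
proof -
  have ray: "einterval (ereal a) \<infinity> = {a<..}" by (auto simp: einterval_def)
  have "(LBINT t=ereal a..\<infinity>. f t) = L - F a"
  proof (rule interval_integral_FTC_integrable)
    show "((F \<circ> real_of_ereal) \<longlongrightarrow> L) (at_left \<infinity>)"
      using lim unfolding ereal_tendsto_simps .
    show "((F \<circ> real_of_ereal) \<longlongrightarrow> F a) (at_right (ereal a))"
      using cont(2) unfolding ereal_tendsto_simps
      by (auto simp: isCont_def intro: tendsto_within_subset)
  qed (use assms in \<open>auto simp: ray\<close>)
  thus ?thesis by (simp add: interval_lebesgue_integral_def ray)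
qed

lemma set_integral_deriv_left_ray:
  fixes h :: "complex \<Rightarrow> complex"
  assumes h: "open S" "h holomorphic_on S" "\<And>t. t \<ge> 0 \<Longrightarrow> c - complex_of_real t \<in> S"
    and int: "set_integrable lborel {0<..} (\<lambda>t. deriv h (c - of_real t))"
    and lim: "((\<lambda>t. h (c - of_real t)) \<longlongrightarrow> 0) at_top"
  shows "(LINT t:{0<..}|lborel. deriv h (c - of_real t)) = h c"
proof -
  have h_deriv: "(h has_field_derivative deriv h (c - of_real t)) (at (c - of_real t))"
    if "t \<ge> 0" for t
    using h that by (intro holomorphic_derivI) auto
  have "(LINT t:{0<..}|lborel. deriv h (c - of_real t)) = 0 - (- h (c - of_real 0))"
  proof (rule set_integral_greaterThan_FTC)
    show "((\<lambda>t. - h (c - of_real t)) has_vector_derivative deriv h (c - of_real t)) (at t)"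
      if "t > 0" for t
    proof -
      have "((\<lambda>z. - h (c - z)) has_field_derivative deriv h (c - of_real t)) (at (of_real t))"
        using that by (auto intro!: derivative_eq_intros
            DERIV_chain2[where f = h and g = "\<lambda>z. c - z", OF h_deriv])
      thus ?thesis by (rule has_vector_derivative_real_field)
    qed
    show "isCont (\<lambda>t. deriv h (c - of_real t)) t" if "t > 0" for t
    proof -
      have "isCont (deriv h) (c - of_real t)"
        using holomorphic_deriv[OF h(2,1)] h(1,3) that
        by (intro analytic_at_imp_isCont) (auto simp: analytic_at)
      thus ?thesis by (rule isCont_o2[rotated]) simp
    qed
    have "isCont h (c - of_real 0)" using h_deriv[of 0] DERIV_isCont by blast
    hence "isCont (\<lambda>t. h (c - of_real t)) 0" by (rule isCont_o2[rotated]) simp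
    thus "isCont (\<lambda>t. - h (c - of_real t)) 0" by simp
    show "((\<lambda>t. - h (c - of_real t)) \<longlongrightarrow> 0) at_top"
      using tendsto_minus[OF lim] by simp
  qed (rule int)
  thus ?thesis by simp
qed

lemma has_field_derivative_integral_left_ray:
  fixes h :: "complex \<Rightarrow> complex"
  assumes h: "open S" "h holomorphic_on S"
    and U: "open U" "c \<in> U" "\<And>z t. z \<in> U \<Longrightarrow> t \<ge> 0 \<Longrightarrow> z - complex_of_real t \<in> S"
    and bound: "\<And>z t. z \<in> U \<Longrightarrow> t \<in> {0<..} \<Longrightarrow> norm (h (z - of_real t)) \<le> g t"
    and g: "set_integrable lborel {0<..} g"
    and lim: "((\<lambda>t. h (c - of_real t)) \<longlongrightarrow> 0) at_top"
  shows "((\<lambda>z. LINT t:{0<..}|lborel. h (z - of_real t)) has_field_derivative h c) (at c)"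
proof -
  have shift: "((\<lambda>z. h (z - of_real t)) has_field_derivative deriv h (z - of_real t)) (at z)"
    if "z \<in> U" "t \<in> {0<..}" for z t
  proof -
    have "(h has_field_derivative deriv h (z - of_real t)) (at (z - of_real t))"
      using h U(3) that by (intro holomorphic_derivI) auto
    thus ?thesis using DERIV_shift[of h _ z "- of_real t"] by simp
  qed
  have meas: "set_borel_measurable lborel {0<..} (\<lambda>t. h (z - of_real t))" if "z \<in> U" for z
  proof -
    have "continuous_on {0<..} (\<lambda>t. h (z - of_real t))"
      using U(3)[OF that]
      by (intro continuous_on_compose2[OF holomorphic_on_imp_continuous_on[OF h(2)]]
            continuous_intros) auto
    thus ?thesis
      using set_measurable_continuous_on[of "{0<..}" "\<lambda>t. h (z - of_real t)"]
      by (simp add: set_borel_measurable_def)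
  qed
  have holo: "(\<lambda>z. h (z - of_real t)) holomorphic_on U" if "t \<in> {0<..}" for t
    unfolding holomorphic_on_open[OF U(1)] using shift that by blast
  have deriv_eq: "deriv (\<lambda>z. h (z - of_real t)) c = deriv h (c - of_real t)" if "t \<in> {0<..}" for t
    using shift[OF U(2) that] by (rule DERIV_imp_deriv)
  have "set_integrable lborel {0<..} (\<lambda>t. deriv (\<lambda>z. h (z - of_real t)) c)"
    by (rule has_field_derivative_set_lebesgue_integral[OF U(1,2) meas holo bound g])
  hence "set_integrable lborel {0<..} (\<lambda>t. deriv h (c - of_real t))"
    by (subst (asm) set_integrable_cong[OF refl refl deriv_eq]) auto
  hence "h c = (LINT t:{0<..}|lborel. deriv h (c - of_real t))"
    using h U lim by (intro set_integral_deriv_left_ray[symmetric]) auto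
  also have "\<dots> = (LINT t:{0<..}|lborel. deriv (\<lambda>z. h (z - of_real t)) c)"
    by (rule set_lebesgue_integral_cong) (auto simp: deriv_eq)
  finally show ?thesis
    using has_field_derivative_set_lebesgue_integral(2)[OF U(1,2) meas holo bound g] by simp
qed

lemma set_integrable_power_mult_exp:
  assumes "c > 0"
  shows "set_integrable lborel {0<..} (\<lambda>t::real. t ^ k * exp (- c * t))"
proof -
  have "set_integrable lebesgue {0<..}
          (\<lambda>t. norm (complex_of_real t powr (of_nat (Suc k) - 1) / of_real (exp (c * t))))"
    using assms by (intro set_integrable_norm absolutely_integrable_Gamma_integral) auto
  moreover have "norm (complex_of_real t powr (of_nat (Suc k) - 1) / of_real (exp (c * t))) =
      t ^ k * exp (- c * t)" if "t \<in> {0<..}" for t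
    using that by (simp add: powr_nat' norm_mult norm_inverse norm_power exp_minus divide_inverse)
  ultimately have "set_integrable lebesgue {0<..} (\<lambda>t. t ^ k * exp (- c * t))"
    by (subst (asm) set_integrable_cong[OF refl refl]) auto
  thus ?thesis
    unfolding set_integrable_def by (subst (asm) integrable_completion) auto
qed

subsection \<open>Elementary functions and the digamma function\<close>

lemma has_field_derivative_one_over_power:
  fixes b :: "'a :: real_normed_field"
  assumes "b \<noteq> 0"
  shows "((\<lambda>b. 1 / b ^ Suc k) has_field_derivative - of_nat (Suc k) * (1 / b ^ Suc (Suc k))) (at b)"
  using DERIV_power_Suc[OF DERIV_inverse[OF assms], of k]
  by (simp add: divide_inverse power_inverse algebra_simps)

lemma higher_deriv_eq_fact_mult:
  fixes F :: "nat \<Rightarrow> 'a \<Rightarrow> 'a :: real_normed_field"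
  assumes "open S" "x \<in> S"
    and deriv: "\<And>k x. x \<in> S \<Longrightarrow> (F k has_field_derivative - of_nat (Suc k) * F (Suc k) x) (at x)"
  shows "(deriv ^^ k) (F 0) x = (-1) ^ k * fact k * F k x"
  using assms(2)
proof (induction k arbitrary: x)
  case (Suc k)
  have "((\<lambda>x. (-1) ^ k * fact k * F k x) has_field_derivative
      (-1) ^ k * fact k * (- of_nat (Suc k) * F (Suc k) x)) (at x)"
    using Suc.prems by (intro DERIV_cmult deriv)
  hence "((deriv ^^ k) (F 0) has_field_derivative
      (-1) ^ k * fact k * (- of_nat (Suc k) * F (Suc k) x)) (at x)"
    by (rule has_field_derivative_transform_within_open[OF _ assms(1) Suc.prems]) (simp add: Suc.IH)
  thus ?case by (simp add: DERIV_imp_deriv algebra_simps)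
qed simp

lemma plus_one_notin_nonpos_Ints:
  fixes b :: "'a :: ring_char_0"
  assumes "b \<notin> \<int>\<^sub>\<le>\<^sub>0"
  shows "b + 1 \<notin> \<int>\<^sub>\<le>\<^sub>0"
  using assms nonpos_Ints_diff_Nats[of "b + 1" 1] by auto

lemma notin_Ints_imp_notin_nonpos_Ints:
  fixes a :: "'a :: ring_1"
  assumes "a \<notin> \<int>"
  shows "a \<notin> \<int>\<^sub>\<le>\<^sub>0" "1 - a \<notin> \<int>\<^sub>\<le>\<^sub>0"
  using assms nonpos_Ints_Int by (auto dest: Ints_diff[OF Ints_1])

lemma connected_Compl_nonpos_Ints: "connected (- \<int>\<^sub>\<le>\<^sub>0 :: complex set)"
proof -
  have "countable (\<int>\<^sub>\<le>\<^sub>0 :: complex set)"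
    by (rule countable_subset[OF nonpos_Ints_subset_Ints countable_int])
  thus ?thesis
    using connected_open_diff_countable[of "UNIV :: complex set" "\<int>\<^sub>\<le>\<^sub>0"]
    by (simp add: Compl_eq_Diff_UNIV connected_UNIV)
qed

lemma nonneg_Reals_inverse_iff: "inverse z \<in> \<real>\<^sub>\<ge>\<^sub>0 \<longleftrightarrow> z \<in> \<real>\<^sub>\<ge>\<^sub>0" for z :: complex
  using nonneg_Reals_inverse_I[of z] nonneg_Reals_inverse_I[of "inverse z"] by auto

lemma notin_Reals_of_Arg_less_pi:
  assumes "0 < norm z" "norm z < 1" "Arg z < pi" "z \<notin> complex_of_real ` {0<..<1}"
  shows "z \<notin> \<real>"
proof
  assume "z \<in> \<real>"
  then obtain r where r: "z = of_real r" by (auto elim: Reals_cases)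
  hence "r > 0" using assms(1,3) by (cases "r < 0") auto
  thus False using assms(2,4) r by auto
qed

lemma open_abs_Im_less: "open {z. \<bar>Im z\<bar> < r}"
  by (intro open_Collect_less continuous_intros)

lemma convex_abs_Im_less: "convex {z. \<bar>Im z\<bar> < r}"
proof -
  have "{z. \<bar>Im z\<bar> < r} = {z. Im z < r} \<inter> {z. Im z > - r}" by auto
  thus ?thesis by (simp add: convex_Int convex_halfspace_Im_gt convex_halfspace_Im_lt)
qed

lemma one_plus_exp_nonzero:
  assumes "\<bar>Im z\<bar> < pi"
  shows "1 + exp z \<noteq> 0"
proof
  assume "1 + exp z = 0"
  hence "exp z = -1" by (simp add: add_eq_0_iff)
  moreover have "z = Ln (exp z)" using assms by (simp add: Ln_exp)
  ultimately show False using assms by simp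
qed

lemma abs_Im_Ln_minus_less_pi:
  assumes "z \<notin> \<real>\<^sub>\<ge>\<^sub>0"
  shows "\<bar>Im (Ln (- z))\<bar> < pi"
proof -
  have "z \<noteq> 0" using assms by auto
  moreover have "Im (Ln (- z)) \<noteq> pi"
    using assms \<open>z \<noteq> 0\<close> by (auto simp: Im_Ln_eq_pi complex_nonneg_Reals_iff)
  ultimately show ?thesis
    using Im_Ln_le_pi[of "- z"] mpi_less_Im_Ln[of "- z"] by simp
qed

lemma sgn_Arg:
  assumes "z \<notin> \<real>"
  shows "sgn (Arg z) = sgn (Im z)"
  using assms Arg_neg_iff[of z] Arg_pos_iff[of z]
  by (auto simp: sgn_if complex_is_Real_iff)

lemma sgn_Arg_minus_Ln:
  assumes "z \<notin> \<real>"
  shows "sgn (Arg (- Ln z)) = - sgn (Im z)"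
proof -
  have "Im (Ln z) = Arg z" using assms by (subst Arg_eq_Im_Ln) auto
  moreover have "Arg z \<noteq> 0" using assms Arg_eq_0 by blast
  ultimately show ?thesis
    using sgn_Arg[OF assms] sgn_Arg[of "- Ln z"] by (simp add: complex_is_Real_iff sgn_minus)
qed

lemma Ln_minus_eq_sgn:
  assumes "z \<notin> \<real>"
  shows "Ln (- z) = Ln z - of_real (sgn (Im z)) * \<i> * of_real pi"
proof -
  have "z \<noteq> 0" "Im z \<noteq> 0" using assms by (auto simp: complex_is_Real_iff)
  thus ?thesis by (auto simp: Ln_minus sgn_if)
qed

lemma exp_Ln_minus_over_sin:
  assumes z: "z \<notin> \<real>" and a: "sin (of_real pi * a) \<noteq> 0"
  shows "exp (- a * Ln (- z)) / sin (of_real pi * a) =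
           exp (- a * Ln z) * (cot (of_real pi * a) - of_real (sgn (Arg (- Ln z))) * \<i>)"
proof -
  define \<sigma> x where "\<sigma> = sgn (Im z)" and "x = of_real pi * a"
  have "\<sigma> = 1 \<or> \<sigma> = -1" using z by (auto simp: \<sigma>_def sgn_if complex_is_Real_iff)
  hence Euler: "exp (of_real \<sigma> * (\<i> * x)) = cos x + of_real \<sigma> * \<i> * sin x"
    using exp_Euler[of x] exp_minus_Euler[of x] by auto
  have "- a * Ln (- z) = - a * Ln z + of_real \<sigma> * (\<i> * x)"
    by (simp add: Ln_minus_eq_sgn[OF z] \<sigma>_def x_def algebra_simps)
  hence "exp (- a * Ln (- z)) / sin x =
      exp (- a * Ln z) * ((cos x + of_real \<sigma> * \<i> * sin x) / sin x)"
    by (simp only: exp_add Euler times_divide_eq_right)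
  also have "(cos x + of_real \<sigma> * \<i> * sin x) / sin x =
      cot x - of_real (sgn (Arg (- Ln z))) * \<i>"
    using a by (simp add: sgn_Arg_minus_Ln[OF z] \<sigma>_def x_def cot_def add_divide_distrib)
  finally show ?thesis by (simp add: x_def)
qed

lemma cot_add_tan_complex:
  fixes x :: complex
  assumes "sin x \<noteq> 0" "cos x \<noteq> 0"
  shows "cot x + tan x = 2 / sin (2 * x)"
proof -
  have "cot x + tan x = ((cos x)\<^sup>2 + (sin x)\<^sup>2) / (sin x * cos x)"
    using assms by (simp add: cot_def tan_def power2_eq_square divide_simps)
  also have "(cos x)\<^sup>2 + (sin x)\<^sup>2 = 1" by simp
  finally show ?thesis by (simp add: sin_double)
qed

lemma Digamma_diff_sums:
  fixes x y :: "'a :: {banach, real_normed_field}"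
  assumes "x \<noteq> 0" "y \<noteq> 0"
  shows "(\<lambda>n. inverse (x + of_nat n) - inverse (y + of_nat n)) sums (Digamma y - Digamma x)"
  unfolding sums_def
  using tendsto_diff[OF Digamma_LIMSEQ[OF assms(2)] Digamma_LIMSEQ[OF assms(1)]]
  by (simp add: sum_subtractf)

lemma Digamma_reflection_complex:
  fixes z :: complex
  assumes "z \<notin> \<int>"
  shows "Digamma (1 - z) - Digamma z = of_real pi * cot (of_real pi * z)"
proof -
  define p s where "p = complex_of_real pi" and "s = sin (p * z)"
  note nonpos = notin_Ints_imp_notin_nonpos_Ints[OF assms]
  have nz: "p \<noteq> 0" "s \<noteq> 0"
    using assms by (auto simp: p_def s_def sin_eq_0)
  have "((\<lambda>z. Gamma z * Gamma (1 - z)) has_field_derivative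
          Gamma z * Gamma (1 - z) * (Digamma z - Digamma (1 - z))) (at z)"
    using nonpos by (auto intro!: derivative_eq_intros simp: algebra_simps)
  moreover have "((\<lambda>z. p / sin (p * z)) has_field_derivative - (p / s * (p * cot (p * z)))) (at z)"
    using nz by (auto intro!: derivative_eq_intros simp: s_def cot_def)
  ultimately have "p / s * (Digamma z - Digamma (1 - z)) = - (p / s * (p * cot (p * z)))"
    unfolding Gamma_reflection_complex p_def s_def by (rule DERIV_unique)
  hence "Digamma z - Digamma (1 - z) = - (p * cot (p * z))"
    unfolding mult_minus_right[symmetric] mult_cancel_left using nz by simp
  thus ?thesis by (simp add: p_def algebra_simps)
qed

subsection \<open>The Laplace integral\<close>

definition lerch_domain :: "complex set" where
  "lerch_domain = - (complex_of_real ` {1..})"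

lemma zero_in_lerch_domain: "0 \<in> lerch_domain"
  by (auto simp: lerch_domain_def)

lemma notin_nonneg_Reals_imp_lerch_domain: "z \<notin> \<real>\<^sub>\<ge>\<^sub>0 \<Longrightarrow> z \<in> lerch_domain"
  by (auto simp: lerch_domain_def)

lemma minus_exp_in_lerch_domain:
  assumes "\<bar>Im c\<bar> < pi"
  shows "- exp c \<in> lerch_domain"
  unfolding lerch_domain_def
proof
  assume "- exp c \<in> complex_of_real ` {1..}"
  then obtain r where r: "r \<ge> 1" "exp c = - complex_of_real r"
    by (auto simp: minus_equation_iff)
  have "c = Ln (exp c)" using assms by (simp add: Ln_exp)
  hence "Im c = pi" using r by (simp add: Im_Ln_eq_pi)
  thus False using assms by simp
qed

lemma minus_one_in_lerch_domain: "-1 \<in> lerch_domain"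
  using minus_exp_in_lerch_domain[of 0] by simp

lemma one_minus_mult_exp_nonzero:
  assumes "w \<in> lerch_domain" "t \<ge> (0::real)"
  shows "1 - w * exp (- of_real t) \<noteq> 0"
proof
  assume "1 - w * exp (- of_real t) = 0"
  hence "w = of_real (exp t)"
    by (simp add: exp_minus field_simps exp_of_real)
  thus False using assms by (auto simp: lerch_domain_def)
qed

definition lerch_kernel :: "complex \<Rightarrow> real \<Rightarrow> complex" where
  "lerch_kernel w t = 1 / (1 - w * exp (- of_real t))"

lemma lerch_kernel_bounded:
  assumes K: "compact K" "K \<subseteq> lerch_domain"
  shows "\<exists>B. \<forall>w\<in>K. \<forall>t\<ge>0. norm (lerch_kernel w t) \<le> B"
proof -
  define \<kappa> where "\<kappa> = (\<lambda>(w::complex, u::real). 1 / (1 - w * of_real u))"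
  have "1 - w * of_real u \<noteq> 0" if "w \<in> K" "u \<in> {0..1}" for w and u :: real
  proof (cases "u = 0")
    case False
    hence "of_real u = exp (- complex_of_real (- ln u))"
      using that by (simp add: exp_of_real flip: of_real_minus)
    thus ?thesis
      using one_minus_mult_exp_nonzero[of w "- ln u"] that K False by (auto simp: ln_le_zero_iff)
  qed auto
  hence "continuous_on (K \<times> {0..1}) \<kappa>"
    by (auto simp: \<kappa>_def case_prod_unfold intro!: continuous_intros)
  hence "bounded (\<kappa> ` (K \<times> {0..1}))"
    using K by (intro compact_imp_bounded compact_continuous_image compact_Times) auto
  then obtain B where B: "\<And>p. p \<in> K \<times> {0..1} \<Longrightarrow> norm (\<kappa> p) \<le> B"
    unfolding bounded_iff by blast
  show ?thesis
  proof (intro exI ballI allI impI)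
    fix w and t :: real assume "w \<in> K" "t \<ge> 0"
    moreover have "lerch_kernel w t = \<kappa> (w, exp (- t))"
      by (simp add: lerch_kernel_def \<kappa>_def exp_of_real flip: of_real_minus)
    ultimately show "norm (lerch_kernel w t) \<le> B"
      using B[of "(w, exp (- t))"] by simp
  qed
qed

lemma lerch_kernel_bounded_at:
  assumes "w \<in> lerch_domain"
  obtains B where "\<And>t. t \<ge> 0 \<Longrightarrow> norm (lerch_kernel w t) \<le> B"
  using lerch_kernel_bounded[of "{w}"] assms by auto

text \<open>The index \<open>k\<close> belongs to the order \<open>k + 1\<close> of the Lerch transcendent.\<close>

definition lerch_integrand :: "complex \<Rightarrow> nat \<Rightarrow> complex \<Rightarrow> real \<Rightarrow> complex" where
  "lerch_integrand w k b t = of_real t ^ k / fact k * exp (- b * of_real t) * lerch_kernel w t"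

definition lerch_laplace :: "complex \<Rightarrow> nat \<Rightarrow> complex \<Rightarrow> complex" where
  "lerch_laplace w k b = (LINT t:{0<..}|lborel. lerch_integrand w k b t)"

lemma set_borel_measurable_lerch_integrand:
  "set_borel_measurable lborel {0<..} (lerch_integrand w k b)"
  unfolding set_borel_measurable_def lerch_integrand_def lerch_kernel_def by measurable

lemma norm_lerch_integrand_le:
  assumes "norm (lerch_kernel w t) \<le> B" "c \<le> Re b" "t > 0"
  shows "norm (lerch_integrand w k b t) \<le> B / fact k * (t ^ k * exp (- c * t))"
proof -
  have "norm (lerch_integrand w k b t) =
      norm (lerch_kernel w t) / fact k * (t ^ k * exp (- Re b * t))"
    using assms(3) by (simp add: lerch_integrand_def norm_divide norm_mult norm_power)
  also have "\<dots> \<le> B / fact k * (t ^ k * exp (- c * t))"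
    using assms order_trans[OF norm_ge_zero assms(1)]
    by (intro mult_mono divide_right_mono mult_left_mono) auto
  finally show ?thesis .
qed

lemma set_integrable_lerch_integrand:
  assumes w: "w \<in> lerch_domain" and b: "Re b > 0"
  shows "set_integrable lborel {0<..} (lerch_integrand w k b)"
proof -
  obtain B where B: "\<And>t. t \<ge> 0 \<Longrightarrow> norm (lerch_kernel w t) \<le> B"
    using lerch_kernel_bounded_at[OF w] by blast
  have "set_integrable lborel {0<..} (\<lambda>t. B / fact k * (t ^ k * exp (- Re b * t)))"
    using b by (intro set_integrable_mult_right set_integrable_power_mult_exp)
  thus ?thesis
    using norm_lerch_integrand_le[OF B order_refl]
    by (rule set_integrable_dominated[OF _ set_borel_measurable_lerch_integrand]) auto
qed

lemma lerch_integrand_has_field_derivative: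
  "((\<lambda>b. lerch_integrand w k b t) has_field_derivative
      - of_nat (Suc k) * lerch_integrand w (Suc k) b t) (at b)"
proof -
  have "((\<lambda>b. exp (- b * of_real t)) has_field_derivative
      - of_real t * exp (- b * of_real t)) (at b)"
    by (auto intro!: derivative_eq_intros)
  from DERIV_cmult[OF this, of "of_real t ^ k / fact k * lerch_kernel w t"]
  show ?thesis
    by (simp add: lerch_integrand_def mult_ac del: of_nat_Suc)
qed

lemma lerch_laplace_has_field_derivative:
  assumes w: "w \<in> lerch_domain" and b: "Re b > 0"
  shows "(lerch_laplace w k has_field_derivative
            - of_nat (Suc k) * lerch_laplace w (Suc k) b) (at b)"
proof -
  obtain B where B: "\<And>t. t \<ge> 0 \<Longrightarrow> norm (lerch_kernel w t) \<le> B"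
    using lerch_kernel_bounded_at[OF w] by blast
  define S where "S = {c. Re c > Re b / 2}"
  have "((\<lambda>c. LINT t:{0<..}|lborel. lerch_integrand w k c t) has_field_derivative
          (LINT t:{0<..}|lborel. deriv (\<lambda>c. lerch_integrand w k c t) b)) (at b)"
  proof (rule has_field_derivative_set_lebesgue_integral)
    show "open S" unfolding S_def by (rule open_halfspace_Re_gt)
    show "b \<in> S" using b by (simp add: S_def)
    show "(\<lambda>c. lerch_integrand w k c t) holomorphic_on S" for t
      unfolding holomorphic_on_open[OF \<open>open S\<close>] using lerch_integrand_has_field_derivative by blast
    show "norm (lerch_integrand w k c t) \<le> B / fact k * (t ^ k * exp (- (Re b / 2) * t))"
      if "c \<in> S" "t \<in> {0<..}" for c t
      using that by (intro norm_lerch_integrand_le B) (auto simp: S_def)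
    show "set_integrable lborel {0<..} (\<lambda>t. B / fact k * (t ^ k * exp (- (Re b / 2) * t)))"
      using b by (intro set_integrable_mult_right set_integrable_power_mult_exp) auto
  qed (rule set_borel_measurable_lerch_integrand)
  thus ?thesis
    by (simp only: DERIV_imp_deriv[OF lerch_integrand_has_field_derivative] set_integral_mult_right
        lerch_laplace_def[abs_def])
qed

lemma lerch_laplace_0:
  assumes "Re b > 0"
  shows "lerch_laplace 0 k b = 1 / b ^ Suc k"
  using assms
proof (induction k arbitrary: b)
  case 0
  have nz: "b \<noteq> 0" using 0 by auto
  have "(LINT t:{0<..}|lborel. exp (- b * of_real t)) = 0 - (- exp (- b * of_real 0) / b)"
  proof (rule set_integral_greaterThan_FTC)
    show "((\<lambda>t. - exp (- b * of_real t) / b) has_vector_derivative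
        exp (- b * of_real t)) (at t)" for t
    proof -
      have "((\<lambda>t. - exp (- b * t) / b) has_field_derivative exp (- b * of_real t)) (at (of_real t))"
        using nz by (auto intro!: derivative_eq_intros)
      thus ?thesis by (rule has_vector_derivative_real_field)
    qed
    show "set_integrable lborel {0<..} (\<lambda>t. exp (- b * of_real t))"
      using set_integrable_lerch_integrand[OF zero_in_lerch_domain 0, of 0]
      by (simp add: lerch_integrand_def[abs_def] lerch_kernel_def)
    have "((\<lambda>t. exp (- (Re b * t)) / norm b) \<longlongrightarrow> 0) at_top"
      using 0 nz by real_asymp
    thus "((\<lambda>t. - exp (- b * of_real t) / b) \<longlongrightarrow> 0) at_top"
      by (intro tendsto_norm_zero_cancel[where f = "\<lambda>t. - exp (- b * of_real t) / b"])
         (simp add: norm_divide)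
  qed (use nz in \<open>auto intro!: continuous_intros\<close>)
  thus ?case by (simp add: lerch_laplace_def lerch_integrand_def lerch_kernel_def)
next
  case (Suc k)
  have nz: "b \<noteq> 0" using Suc.prems by auto
  have "(lerch_laplace 0 k has_field_derivative
      - of_nat (Suc k) * lerch_laplace 0 (Suc k) b) (at b)"
    using zero_in_lerch_domain Suc.prems by (rule lerch_laplace_has_field_derivative)
  moreover have "(lerch_laplace 0 k has_field_derivative
      - of_nat (Suc k) * (1 / b ^ Suc (Suc k))) (at b)"
  proof (rule has_field_derivative_transform_within_open)
    show "((\<lambda>b. 1 / b ^ Suc k) has_field_derivative
        - of_nat (Suc k) * (1 / b ^ Suc (Suc k))) (at b)"
      using nz by (rule has_field_derivative_one_over_power)
    show "open {c. Re c > 0}" by (rule open_halfspace_Re_gt)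
  qed (use Suc in auto)
  ultimately have "- of_nat (Suc k) * lerch_laplace 0 (Suc k) b =
      - of_nat (Suc k) * (1 / b ^ Suc (Suc k))"
    by (rule DERIV_unique)
  thus ?case unfolding mult_cancel_left neg_equal_0_iff_equal using of_nat_neq_0 by blast
qed

lemma lerch_laplace_shift:
  assumes w: "w \<in> lerch_domain" and b: "Re b > 0"
  shows "lerch_laplace w k b = 1 / b ^ Suc k + w * lerch_laplace w k (b + 1)"
proof -
  have "lerch_integrand w k b t = lerch_integrand 0 k b t + w * lerch_integrand w k (b + 1) t"
    if "t \<in> {0<..}" for t
  proof -
    have "exp (- (b + 1) * of_real t) = exp (- b * of_real t) * exp (- of_real t)"
      by (simp add: algebra_simps flip: exp_add)
    thus ?thesis
      using one_minus_mult_exp_nonzero[OF w, of t] that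
      by (simp add: lerch_integrand_def lerch_kernel_def field_simps)
  qed
  hence "lerch_laplace w k b =
      (LINT t:{0<..}|lborel. lerch_integrand 0 k b t + w * lerch_integrand w k (b + 1) t)"
    unfolding lerch_laplace_def by (intro set_lebesgue_integral_cong) auto
  also have "\<dots> = lerch_laplace 0 k b + w * lerch_laplace w k (b + 1)"
    unfolding lerch_laplace_def using w b zero_in_lerch_domain
    by (simp add: set_integrable_lerch_integrand)
  finally show ?thesis using lerch_laplace_0[OF b] by simp
qed

lemma norm_lerch_laplace_le:
  assumes w: "w \<in> lerch_domain" and b: "Re b > 0"
    and B: "\<And>t. t \<ge> 0 \<Longrightarrow> norm (lerch_kernel w t) \<le> B"
  shows "norm (lerch_laplace w k b) \<le> B / Re b ^ Suc k"
proof -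
  define f where "f t = t ^ k / fact k * exp (- Re b * t)" for t
  have "complex_of_real (LINT t:{0<..}|lborel. f t) = lerch_laplace 0 k (of_real (Re b))"
    by (simp add: lerch_laplace_def lerch_integrand_def lerch_kernel_def f_def
        flip: set_integral_complex_of_real exp_of_real)
  also have "\<dots> = of_real (1 / Re b ^ Suc k)"
    using lerch_laplace_0[of "of_real (Re b)" k] b by simp
  finally have f: "(LINT t:{0<..}|lborel. f t) = 1 / Re b ^ Suc k"
    unfolding of_real_eq_iff .
  have "norm (lerch_laplace w k b) \<le> (LINT t:{0<..}|lborel. norm (lerch_integrand w k b t))"
    unfolding lerch_laplace_def using set_integrable_lerch_integrand[OF w b]
    by (rule set_integral_norm_bound)
  also have "\<dots> \<le> (LINT t:{0<..}|lborel. B * f t)"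
  proof (rule set_integral_mono)
    show "set_integrable lborel {0<..} (\<lambda>t. norm (lerch_integrand w k b t))"
      using set_integrable_lerch_integrand[OF w b] by (rule set_integrable_norm)
    show "set_integrable lborel {0<..} (\<lambda>t. B * f t)"
      using set_integrable_mult_right[OF set_integrable_power_mult_exp[OF b], of "B / fact k" k]
      by (simp add: f_def)
    show "norm (lerch_integrand w k b t) \<le> B * f t" if "t \<in> {0<..}" for t
      using norm_lerch_integrand_le[OF B order_refl] that by (simp add: f_def)
  qed
  finally show ?thesis by (simp add: f)
qed

lemma lerch_laplace_tendsto_0:
  assumes "w \<in> lerch_domain"
  shows "(\<lambda>M. lerch_laplace w k (b + of_nat M)) \<longlonglongrightarrow> 0"
proof -
  obtain B where B: "\<And>t. t \<ge> 0 \<Longrightarrow> norm (lerch_kernel w t) \<le> B"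
    using lerch_kernel_bounded_at[OF assms] by blast
  show ?thesis
  proof (rule Lim_null_comparison)
    have "eventually (\<lambda>M. Re b + real M > 0) sequentially" by real_asymp
    thus "eventually (\<lambda>M. norm (lerch_laplace w k (b + of_nat M)) \<le>
        B / (Re b + real M) ^ Suc k) sequentially"
    proof eventually_elim
      case (elim M)
      thus ?case using norm_lerch_laplace_le[OF assms _ B, of "b + of_nat M" k] by simp
    qed
    show "(\<lambda>M. B / (Re b + real M) ^ Suc k) \<longlonglongrightarrow> 0"
      by real_asymp
  qed
qed

lemma lerch_laplace_eq_lerch_integral:
  assumes "w \<in> lerch_domain" "Re b > 0"
  shows "lerch_laplace w k b = lerch_integral w (of_nat (Suc k)) b"
proof -
  have "lerch_laplace w k b = integral {0<..} (lerch_integrand w k b)"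
    unfolding lerch_laplace_def using set_integrable_lerch_integrand[OF assms]
    by (rule set_borel_integral_eq_integral)
  also have "\<dots> = integral {0<..} (\<lambda>t. 1 / fact k * (of_real t powr (of_nat (Suc k) - 1) *
      exp (- b * of_real t) / (1 - w * exp (- of_real t))))"
    by (intro integral_cong) (simp add: lerch_integrand_def lerch_kernel_def powr_nat')
  also have "\<dots> = lerch_integral w (of_nat (Suc k)) b"
    unfolding lerch_integral_def integral_mult_right of_nat_Suc Gamma_fact ..
  finally show ?thesis .
qed

lemma exp_times_lerch_integrand_dominated:
  assumes "compact K" "\<And>z. z \<in> K \<Longrightarrow> \<bar>Im z\<bar> < pi"
  shows "\<exists>C. \<forall>z\<in>K. \<forall>t>0.
    norm (exp (b * z) * lerch_integrand (- exp z) k b t) \<le> C * (t ^ k * exp (- Re b * t))"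
proof -
  have "compact ((\<lambda>z. - exp z) ` K)" "(\<lambda>z. - exp z) ` K \<subseteq> lerch_domain"
    using assms minus_exp_in_lerch_domain
    by (auto intro!: compact_continuous_image continuous_intros)
  then obtain B where B: "\<forall>w\<in>(\<lambda>z. - exp z) ` K. \<forall>t\<ge>0. norm (lerch_kernel w t) \<le> B"
    using lerch_kernel_bounded by blast
  have "bounded ((\<lambda>z. exp (b * z)) ` K)"
    using assms(1) by (intro compact_imp_bounded compact_continuous_image continuous_intros) auto
  then obtain A where A: "A > 0" "\<And>z. z \<in> K \<Longrightarrow> norm (exp (b * z)) \<le> A"
    unfolding bounded_pos by blast
  show ?thesis
  proof (intro exI ballI allI impI)
    fix z and t :: real assume z: "z \<in> K" and t: "t > 0"
    have "norm (lerch_integrand (- exp z) k b t) \<le> B / fact k * (t ^ k * exp (- Re b * t))"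
      using z t B by (intro norm_lerch_integrand_le) auto
    hence "norm (exp (b * z) * lerch_integrand (- exp z) k b t) \<le>
        A * (B / fact k * (t ^ k * exp (- Re b * t)))"
      using A z unfolding norm_mult by (intro mult_mono) auto
    thus "norm (exp (b * z) * lerch_integrand (- exp z) k b t) \<le>
        A * B / fact k * (t ^ k * exp (- Re b * t))"
      by (simp add: mult.assoc)
  qed
qed

lemma exp_times_lerch_laplace_has_field_derivative:
  assumes b: "Re b > 0" and c: "\<bar>Im c\<bar> < pi"
  shows "((\<lambda>c. exp (b * c) * lerch_laplace (- exp c) 0 b) has_field_derivative
            exp (b * c) / (1 + exp c)) (at c)"
proof -
  define S where "S = {z. \<bar>Im z\<bar> < pi}"
  define h where "h z = exp (b * z) / (1 + exp z)" for z
  have S: "open S" unfolding S_def by (rule open_abs_Im_less)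
  moreover have "c \<in> S" using c by (simp add: S_def)
  ultimately obtain r where r: "r > 0" "cball c r \<subseteq> S"
    using open_contains_cball by blast
  have h_shift: "h (z - of_real t) = exp (b * z) * lerch_integrand (- exp z) 0 b t" for z t
    by (simp add: h_def lerch_integrand_def lerch_kernel_def exp_diff exp_minus field_simps)
  have "\<bar>Im z\<bar> < pi" if "z \<in> cball c r" for z
    using that r(2) by (auto simp: S_def)
  then obtain C where C: "\<forall>z\<in>cball c r. \<forall>t>0.
      norm (exp (b * z) * lerch_integrand (- exp z) 0 b t) \<le> C * (t ^ 0 * exp (- Re b * t))"
    using exp_times_lerch_integrand_dominated[OF compact_cball] by blast
  define g where "g = (\<lambda>t. C * (t ^ 0 * exp (- Re b * t)))"
  have "((\<lambda>z. LINT t:{0<..}|lborel. h (z - of_real t)) has_field_derivative h c) (at c)"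
  proof (rule has_field_derivative_integral_left_ray[where S = S and U = "ball c r" and g = g])
    show "h holomorphic_on S"
      unfolding h_def S_def using one_plus_exp_nonzero by (intro holomorphic_intros) auto
    show "set_integrable lborel {0<..} g"
      unfolding g_def using b by (intro set_integrable_mult_right set_integrable_power_mult_exp)
    show "((\<lambda>t. h (c - of_real t)) \<longlongrightarrow> 0) at_top"
    proof (rule Lim_null_comparison)
      show "\<forall>\<^sub>F t in at_top. norm (h (c - of_real t)) \<le> g t"
        using eventually_gt_at_top[of 0]
        by eventually_elim (use C r in \<open>simp add: h_shift g_def\<close>)
      show "(g \<longlongrightarrow> 0) at_top"
        unfolding g_def power_0 mult_1 using b by real_asymp
    qed
    show "z - of_real t \<in> S" if "z \<in> ball c r" for z t
      using that r(2) by (auto simp: S_def subset_iff)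
    show "norm (h (z - of_real t)) \<le> g t" if "z \<in> ball c r" "t \<in> {0<..}" for z t
      using C that by (simp add: h_shift g_def)
  qed (use S r in simp_all)
  thus ?thesis
    unfolding h_shift set_integral_mult_right by (simp add: h_def lerch_laplace_def)
qed

subsection \<open>Continuation in the shift parameter\<close>

function lerch_ext :: "complex \<Rightarrow> nat \<Rightarrow> complex \<Rightarrow> complex" where
  "lerch_ext w k b =
     (if Re b > 0 then lerch_laplace w k b else 1 / b ^ Suc k + w * lerch_ext w k (b + 1))"
  by auto
termination
  by (relation "Wellfounded.measure (\<lambda>(w, k, b). nat \<lfloor>1 - Re b\<rfloor>)") (auto, linarith)

declare lerch_ext.simps [simp del]

lemma lerch_ext_eq_laplace: "Re b > 0 \<Longrightarrow> lerch_ext w k b = lerch_laplace w k b"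
  by (subst lerch_ext.simps) simp

lemma lerch_ext_shift:
  assumes "w \<in> lerch_domain"
  shows "lerch_ext w k b = 1 / b ^ Suc k + w * lerch_ext w k (b + 1)"
proof (cases "Re b > 0")
  case True
  thus ?thesis using lerch_laplace_shift[OF assms True] by (simp add: lerch_ext_eq_laplace)
qed (subst lerch_ext.simps, simp)

lemma lerch_ext_eq_sum:
  assumes "w \<in> lerch_domain"
  shows "lerch_ext w k b =
    (\<Sum>m<M. w ^ m / (b + of_nat m) ^ Suc k) + w ^ M * lerch_ext w k (b + of_nat M)"
proof (induction M)
  case (Suc M)
  thus ?case
    using lerch_ext_shift[OF assms, of k "b + of_nat M"] by (simp add: algebra_simps)
qed simp

lemma lerch_ext_has_field_derivative:
  assumes "w \<in> lerch_domain" "b \<notin> \<int>\<^sub>\<le>\<^sub>0"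
  shows "(lerch_ext w k has_field_derivative - of_nat (Suc k) * lerch_ext w (Suc k) b) (at b)"
  using assms
proof (induction w k b rule: lerch_ext.induct)
  case (1 w k b)
  show ?case
  proof (cases "Re b > 0")
    case True
    have "(lerch_laplace w k has_field_derivative
        - of_nat (Suc k) * lerch_laplace w (Suc k) b) (at b)"
      using "1.prems"(1) True by (rule lerch_laplace_has_field_derivative)
    hence "(lerch_ext w k has_field_derivative
        - of_nat (Suc k) * lerch_laplace w (Suc k) b) (at b)"
      by (rule has_field_derivative_transform_within_open[OF _ open_halfspace_Re_gt[of 0]])
         (use True in \<open>auto simp: lerch_ext_eq_laplace\<close>)
    thus ?thesis using True by (simp add: lerch_ext_eq_laplace)
  next
    case False
    have "b \<noteq> 0" using "1.prems"(2) by auto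
    have "(lerch_ext w k has_field_derivative
        - of_nat (Suc k) * lerch_ext w (Suc k) (b + 1)) (at (b + 1))"
      using "1.IH"[OF False] "1.prems" plus_one_notin_nonpos_Ints by blast
    hence "((\<lambda>b. lerch_ext w k (b + 1)) has_field_derivative
        - of_nat (Suc k) * lerch_ext w (Suc k) (b + 1)) (at b)"
      by (simp only: DERIV_shift)
    hence "((\<lambda>b. 1 / b ^ Suc k + w * lerch_ext w k (b + 1)) has_field_derivative
        - of_nat (Suc k) * (1 / b ^ Suc (Suc k)) +
        w * (- of_nat (Suc k) * lerch_ext w (Suc k) (b + 1))) (at b)"
      by (intro DERIV_add DERIV_cmult has_field_derivative_one_over_power[OF \<open>b \<noteq> 0\<close>])
    also have "(\<lambda>b. 1 / b ^ Suc k + w * lerch_ext w k (b + 1)) = lerch_ext w k"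
      by (rule ext) (rule lerch_ext_shift[OF "1.prems"(1), symmetric])
    also have "- of_nat (Suc k) * (1 / b ^ Suc (Suc k)) +
          w * (- of_nat (Suc k) * lerch_ext w (Suc k) (b + 1)) =
        - of_nat (Suc k) * lerch_ext w (Suc k) b"
      unfolding lerch_ext_shift[OF "1.prems"(1), of "Suc k" b]
      by (simp only: distrib_left mult.left_commute)
    finally show ?thesis .
  qed
qed

lemma lerch_ext_holomorphic:
  assumes "w \<in> lerch_domain"
  shows "lerch_ext w k holomorphic_on (- \<int>\<^sub>\<le>\<^sub>0)"
  using lerch_ext_has_field_derivative[OF assms] has_field_derivative_at_within
  unfolding holomorphic_on_def field_differentiable_def by blast

lemma lerch_ext_meromorphic:
  assumes "w \<in> lerch_domain"
  shows "lerch_ext w k meromorphic_on UNIV"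
  unfolding meromorphic_on_meromorphic_at[of _ UNIV]
proof
  fix b :: complex
  obtain M :: nat where M: "- Re b < real M" using reals_Archimedean2 by blast
  have "lerch_ext w k meromorphic_on - \<int>\<^sub>\<le>\<^sub>0"
    using lerch_ext_holomorphic[OF assms]
    by (intro analytic_on_imp_meromorphic_on) (simp add: analytic_on_open open_Compl)
  moreover have "b + of_nat M \<notin> \<int>\<^sub>\<le>\<^sub>0"
    using M by (auto elim!: nonpos_Ints_cases simp: complex_eq_iff)
  moreover have "(\<lambda>b. b + of_nat M) analytic_on {b}" by (intro analytic_intros)
  ultimately have "(\<lambda>b. lerch_ext w k (b + of_nat M)) meromorphic_on {b}"
    using meromorphic_on_compose[of "lerch_ext w k" "- \<int>\<^sub>\<le>\<^sub>0" "\<lambda>b. b + of_nat M" "{b}"] by simp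
  hence "(\<lambda>b. (\<Sum>m<M. w ^ m / (b + of_nat m) ^ Suc k) + w ^ M * lerch_ext w k (b + of_nat M))
           meromorphic_on {b}"
    by (intro meromorphic_intros)
  thus "lerch_ext w k meromorphic_on {b}"
    unfolding lerch_ext_eq_sum[OF assms, of k _ M, symmetric] .
qed

lemma lerch_continuation_lerch_ext:
  assumes "w \<in> lerch_domain"
  shows "lerch_continuation w (Suc k) (lerch_ext w k)"
  unfolding lerch_continuation_def
  using lerch_ext_meromorphic[OF assms] lerch_ext_holomorphic[OF assms]
    lerch_laplace_eq_lerch_integral[OF assms]
  by (simp add: lerch_ext_eq_laplace)

lemma lerch_continuation_unique:
  assumes "lerch_continuation w n F" "lerch_continuation w n G" "b \<notin> \<int>\<^sub>\<le>\<^sub>0"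
  shows "F b = G b"
proof -
  have "F b - G b = 0"
  proof (rule analytic_continuation[of "\<lambda>b. F b - G b" "- \<int>\<^sub>\<le>\<^sub>0" "{b. Re b > 0}" 1])
    show "(\<lambda>b. F b - G b) holomorphic_on - \<int>\<^sub>\<le>\<^sub>0"
      using assms by (auto simp: lerch_continuation_def intro!: holomorphic_intros)
    show "(1::complex) islimpt {b. Re b > 0}"
      using open_halfspace_Re_gt[of 0] by (intro interior_limit_point) (simp add: interior_open)
    show "{b. Re b > 0} \<subseteq> - \<int>\<^sub>\<le>\<^sub>0" by (auto elim!: nonpos_Ints_cases)
  qed (use assms connected_Compl_nonpos_Ints in \<open>auto simp: lerch_continuation_def open_Compl\<close>)
  thus ?thesis by simp
qed

lemma lerch_ext_sums:
  assumes "w \<in> lerch_domain" "norm w \<le> 1"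
  shows "(\<lambda>m. w ^ m / (b + of_nat m) ^ Suc k) sums lerch_ext w k b"
proof -
  have lim: "(\<lambda>M. lerch_ext w k (b + of_nat M)) \<longlonglongrightarrow> 0"
  proof (rule Lim_transform_eventually[OF lerch_laplace_tendsto_0[OF assms(1)]])
    have "\<forall>\<^sub>F M in sequentially. Re b + real M > 0" by real_asymp
    thus "\<forall>\<^sub>F M in sequentially. lerch_laplace w k (b + of_nat M) = lerch_ext w k (b + of_nat M)"
      by eventually_elim (simp add: lerch_ext_eq_laplace)
  qed
  have "(\<lambda>M. w ^ M * lerch_ext w k (b + of_nat M)) \<longlonglongrightarrow> 0"
  proof (rule Lim_null_comparison)
    show "\<forall>\<^sub>F M in sequentially. norm (w ^ M * lerch_ext w k (b + of_nat M)) \<le>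
        norm (lerch_ext w k (b + of_nat M))"
      using assms(2) unfolding norm_mult norm_power
      by (intro always_eventually allI mult_left_le_one_le power_le_one) auto
    show "(\<lambda>M. norm (lerch_ext w k (b + of_nat M))) \<longlonglongrightarrow> 0"
      using lim by (rule tendsto_norm_zero)
  qed
  hence "(\<lambda>M. lerch_ext w k b - w ^ M * lerch_ext w k (b + of_nat M)) \<longlonglongrightarrow> lerch_ext w k b - 0"
    by (intro tendsto_diff tendsto_const)
  moreover have "lerch_ext w k b - w ^ M * lerch_ext w k (b + of_nat M) =
      (\<Sum>m<M. w ^ m / (b + of_nat m) ^ Suc k)" for M
    using lerch_ext_eq_sum[OF assms(1), of k b M] by simp
  ultimately show ?thesis by (simp add: sums_def)
qed

lemma lerch_phi_eq_lerch_ext: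
  assumes w: "w \<in> lerch_domain" and b: "b \<notin> \<int>\<^sub>\<le>\<^sub>0"
  shows "lerch_phi w (Suc k) b = lerch_ext w k b"
proof (cases "norm w < 1")
  case True
  have "(b + of_nat m) powr of_nat (Suc k) = (b + of_nat m) ^ Suc k" for m
  proof -
    have "b + of_nat m \<noteq> 0" using b plus_of_nat_eq_0_imp by blast
    thus ?thesis using powr_nat'[of "b + of_nat m" "Suc k"] by blast
  qed
  hence "lerch_series w (of_nat (Suc k)) b = (\<Sum>m. w ^ m / (b + of_nat m) ^ Suc k)"
    by (simp only: lerch_series_def)
  also have "\<dots> = lerch_ext w k b"
    using lerch_ext_sums[OF w, of b k] True by (simp add: sums_iff)
  finally show ?thesis using True by (simp add: lerch_phi_def)
next
  case False
  have "lerch_continuation w (Suc k) (SOME F. lerch_continuation w (Suc k) F)"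
    by (rule someI[of "lerch_continuation w (Suc k)", OF lerch_continuation_lerch_ext[OF w]])
  hence "(SOME F. lerch_continuation w (Suc k) F) b = lerch_ext w k b"
    using lerch_continuation_lerch_ext[OF w] b by (rule lerch_continuation_unique)
  thus ?thesis using False by (simp add: lerch_phi_def)
qed

lemma exp_times_lerch_ext_has_field_derivative:
  assumes "\<bar>Im c\<bar> < pi" "b \<notin> \<int>\<^sub>\<le>\<^sub>0"
  shows "((\<lambda>c. exp (b * c) * lerch_ext (- exp c) 0 b) has_field_derivative
            exp (b * c) / (1 + exp c)) (at c)"
  using assms
proof (induction "- exp c" "0 :: nat" b rule: lerch_ext.induct)
  case (1 b)
  show ?case
  proof (cases "Re b > 0")
    case True
    thus ?thesis
      using exp_times_lerch_laplace_has_field_derivative[OF True "1.prems"(1)]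
      by (simp add: lerch_ext_eq_laplace)
  next
    case False
    have nz: "b \<noteq> 0" "1 + exp c \<noteq> 0"
      using "1.prems" one_plus_exp_nonzero by auto
    have "((\<lambda>c. exp ((b + 1) * c) * lerch_ext (- exp c) 0 (b + 1)) has_field_derivative
        exp ((b + 1) * c) / (1 + exp c)) (at c)"
      using "1.hyps" False "1.prems" plus_one_notin_nonpos_Ints by blast
    moreover have "((\<lambda>c. exp (b * c) / b) has_field_derivative exp (b * c)) (at c)"
      using nz by (auto intro!: derivative_eq_intros)
    ultimately have "((\<lambda>c. exp (b * c) / b - exp ((b + 1) * c) * lerch_ext (- exp c) 0 (b + 1))
        has_field_derivative exp (b * c) - exp ((b + 1) * c) / (1 + exp c)) (at c)"
      by (intro DERIV_diff)
    also have "exp (b * c) - exp ((b + 1) * c) / (1 + exp c) = exp (b * c) / (1 + exp c)"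
      using nz(2) by (simp add: distrib_right exp_add field_simps)
    finally show ?thesis
    proof (rule has_field_derivative_transform_within_open[OF _ open_abs_Im_less])
      show "c \<in> {z. \<bar>Im z\<bar> < pi}" using "1.prems"(1) by simp
      fix z assume "z \<in> {z. \<bar>Im z\<bar> < pi}"
      thus "exp (b * z) / b - exp ((b + 1) * z) * lerch_ext (- exp z) 0 (b + 1) =
          exp (b * z) * lerch_ext (- exp z) 0 b"
        by (subst lerch_ext_shift[OF minus_exp_in_lerch_domain, of z 0 b])
           (simp_all add: exp_add algebra_simps)
    qed
  qed
qed

subsection \<open>The reflection formula\<close>

lemma lerch_ext_minus_one:
  assumes "b \<notin> \<int>\<^sub>\<le>\<^sub>0"
  shows "lerch_ext (-1) 0 b = (Digamma ((b + 1) / 2) - Digamma (b / 2)) / 2"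
proof -
  have nz: "b + of_nat m \<noteq> 0" for m
    using assms plus_of_nat_eq_0_imp by blast
  have "(\<lambda>m. (-1) ^ m / (b + of_nat m)) sums lerch_ext (-1) 0 b"
    using lerch_ext_sums[OF minus_one_in_lerch_domain, of b 0] by simp
  from sums_group[OF this, of 2]
  have "(\<lambda>m. \<Sum>j=m * 2..<m * 2 + 2. (-1) ^ j / (b + of_nat j)) sums lerch_ext (-1) 0 b"
    by simp
  moreover have "(\<Sum>j=m * 2..<m * 2 + 2. (-1) ^ j / (b + of_nat j)) =
      (inverse (b / 2 + of_nat m) - inverse ((b + 1) / 2 + of_nat m)) / 2" for m
  proof -
    have "b / 2 + of_nat m = (b + of_nat (m * 2)) / 2"
      "(b + 1) / 2 + of_nat m = (b + of_nat (Suc (m * 2))) / 2"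
      by (simp_all add: field_simps)
    moreover have "{m * 2..<m * 2 + 2} = {m * 2, Suc (m * 2)}" by auto
    ultimately show ?thesis by (simp add: inverse_eq_divide diff_divide_distrib)
  qed
  ultimately have "(\<lambda>m. (inverse (b / 2 + of_nat m) - inverse ((b + 1) / 2 + of_nat m)) / 2)
      sums lerch_ext (-1) 0 b"
    by (simp only:)
  moreover have "(\<lambda>m. (inverse (b / 2 + of_nat m) - inverse ((b + 1) / 2 + of_nat m)) / 2)
      sums ((Digamma ((b + 1) / 2) - Digamma (b / 2)) / 2)"
    using nz[of 0] nz[of 1] by (intro sums_divide Digamma_diff_sums) auto
  ultimately show ?thesis by (rule sums_unique2)
qed

lemma lerch_ext_reflection_minus_one:
  assumes "a \<notin> \<int>"
  shows "lerch_ext (-1) 0 a + lerch_ext (-1) 0 (1 - a) = of_real pi / sin (of_real pi * a)"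
proof -
  define x where "x = of_real pi * (a / 2)"
  have half_notin_Ints: "y / 2 \<notin> \<int>" if "y \<notin> \<int>" for y :: complex
    using that Ints_mult[of 2 "y / 2"] by auto
  have "1 - a \<notin> \<int>" using assms Ints_diff[OF Ints_1, of "1 - a"] by auto
  note halves = half_notin_Ints[OF assms] half_notin_Ints[OF this]
  have complement: "of_real pi * ((1 - a) / 2) = of_real pi / 2 - x"
    by (simp add: x_def field_simps)
  have nz: "sin x \<noteq> 0" "cos x \<noteq> 0"
  proof -
    show "sin x \<noteq> 0" using halves(1) by (auto simp: x_def sin_eq_0)
    have "sin (of_real pi * ((1 - a) / 2)) \<noteq> 0"
      using halves(2) by (auto simp: sin_eq_0)
    thus "cos x \<noteq> 0" unfolding complement by (simp add: sin_diff)
  qed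
  have "lerch_ext (-1) 0 a + lerch_ext (-1) 0 (1 - a) =
      ((Digamma (1 - a / 2) - Digamma (a / 2)) +
       (Digamma (1 - (1 - a) / 2) - Digamma ((1 - a) / 2))) / 2"
    using notin_Ints_imp_notin_nonpos_Ints[OF assms] by (simp add: lerch_ext_minus_one field_simps)
  also have "\<dots> = of_real pi * (cot x + cot (of_real pi / 2 - x)) / 2"
    unfolding halves[THEN Digamma_reflection_complex] complement x_def[symmetric]
    by (simp only: distrib_left)
  also have "cot (of_real pi / 2 - x) = tan x"
    by (simp add: cot_def tan_def sin_diff cos_diff)
  also have "cot x + tan x = 2 / sin (2 * x)" using nz by (rule cot_add_tan_complex)
  also have "2 * x = of_real pi * a" by (simp add: x_def)
  finally show ?thesis by simp
qed

lemma lerch_ext_reflection_exp: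
  assumes a: "a \<notin> \<int>" and c: "\<bar>Im c\<bar> < pi"
  shows "exp (a * c) * lerch_ext (- exp c) 0 a +
           exp ((1 - a) * - c) * lerch_ext (- exp (- c)) 0 (1 - a) =
         of_real pi / sin (of_real pi * a)"
    (is "?K c = _")
proof -
  define S where "S = {c. \<bar>Im c\<bar> < pi}"
  note nonpos = notin_Ints_imp_notin_nonpos_Ints[OF a]
  have "(?K has_field_derivative 0) (at c within S)" if "c \<in> S" for c
  proof -
    have Im: "\<bar>Im c\<bar> < pi" "\<bar>Im (- c)\<bar> < pi" using that by (auto simp: S_def)
    have "(?K has_field_derivative
        exp (a * c) / (1 + exp c) + exp ((1 - a) * - c) / (1 + exp (- c)) * -1) (at c)"
      using nonpos Im
      by (intro DERIV_add exp_times_lerch_ext_has_field_derivative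
            DERIV_chain2[OF exp_times_lerch_ext_has_field_derivative, where g = uminus])
         (auto intro!: derivative_eq_intros)
    moreover have "exp ((1 - a) * - c) / (1 + exp (- c)) = exp (a * c) / (1 + exp c)"
    proof -
      have "exp (a * c) = exp c * exp ((1 - a) * - c)" "1 + exp c = exp c * (1 + exp (- c))"
        by (simp_all add: algebra_simps flip: exp_add)
      thus ?thesis by (simp only: mult_divide_mult_cancel_left[OF exp_not_eq_zero])
    qed
    ultimately show ?thesis by (auto intro: has_field_derivative_at_within)
  qed
  moreover have "convex S" unfolding S_def by (rule convex_abs_Im_less)
  ultimately obtain C where C: "?K c = C" if "c \<in> S" for c
    using has_field_derivative_zero_constant[of S ?K] by blast
  have "?K c = ?K 0"
    by (rule trans[OF C C[symmetric]]) (use c in \<open>auto simp: S_def\<close>)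
  thus ?thesis using lerch_ext_reflection_minus_one[OF a] by simp
qed

definition lerch_reflection :: "complex \<Rightarrow> nat \<Rightarrow> complex \<Rightarrow> complex" where
  "lerch_reflection z k a =
     lerch_ext z k a + (-1) ^ Suc k * inverse z * lerch_ext (inverse z) k (1 - a)"

lemma lerch_reflection_0:
  assumes z: "z \<notin> \<real>\<^sub>\<ge>\<^sub>0" and a: "a \<notin> \<int>"
  shows "lerch_reflection z 0 a = of_real pi * (exp (- a * Ln (- z)) / sin (of_real pi * a))"
proof -
  define c where "c = Ln (- z)"
  have "z \<noteq> 0" using z by auto
  hence exp_c: "- exp c = z" "- exp (- c) = inverse z"
    by (simp_all add: c_def exp_minus)
  have "exp (- a * c) * exp (a * c) = 1" "exp (- a * c) * exp ((1 - a) * - c) = - inverse z"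
    unfolding exp_c(2)[symmetric] by (simp_all add: algebra_simps flip: exp_add)
  hence "lerch_reflection z 0 a =
      exp (- a * c) * (exp (a * c) * lerch_ext (- exp c) 0 a +
        exp ((1 - a) * - c) * lerch_ext (- exp (- c)) 0 (1 - a))"
    unfolding lerch_reflection_def exp_c distrib_left mult.assoc[symmetric] by simp
  also have "\<dots> = exp (- a * c) * (of_real pi / sin (of_real pi * a))"
    using a abs_Im_Ln_minus_less_pi[OF z] unfolding c_def by (subst lerch_ext_reflection_exp) auto
  finally show ?thesis by (simp add: c_def)
qed

lemma lerch_reflection_has_field_derivative:
  assumes "z \<notin> \<real>\<^sub>\<ge>\<^sub>0" "a \<notin> \<int>"
  shows "(lerch_reflection z k has_field_derivative
            - of_nat (Suc k) * lerch_reflection z (Suc k) a) (at a)"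
proof -
  have dom: "z \<in> lerch_domain" "inverse z \<in> lerch_domain"
    using assms(1)
    by (auto intro!: notin_nonneg_Reals_imp_lerch_domain simp: nonneg_Reals_inverse_iff)
  note nonpos = notin_Ints_imp_notin_nonpos_Ints[OF assms(2)]
  have "((\<lambda>a. lerch_ext (inverse z) k (1 - a)) has_field_derivative
      - of_nat (Suc k) * lerch_ext (inverse z) (Suc k) (1 - a) * -1) (at a)"
    by (rule DERIV_chain2[where f = "lerch_ext (inverse z) k" and g = "\<lambda>a. 1 - a",
          OF lerch_ext_has_field_derivative[OF dom(2) nonpos(2)]])
       (auto intro!: derivative_eq_intros)
  hence "(lerch_reflection z k has_field_derivative
      - of_nat (Suc k) * lerch_ext z (Suc k) a +
      (-1) ^ Suc k * inverse z *
        (- of_nat (Suc k) * lerch_ext (inverse z) (Suc k) (1 - a) * -1)) (at a)"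
    unfolding lerch_reflection_def[abs_def]
    by (intro DERIV_add DERIV_cmult lerch_ext_has_field_derivative dom nonpos)
  thus ?thesis by (simp add: lerch_reflection_def algebra_simps)
qed

lemma lerch_reflection_eq_higher_deriv:
  assumes z: "z \<notin> \<real>" and a: "a \<notin> \<int>"
  defines "R \<equiv> \<lambda>b. exp (- b * Ln z) *
    (cot (of_real pi * b) - of_real (sgn (Arg (- Ln z))) * \<i>)"
  shows "lerch_reflection z k a = of_real pi * (-1) ^ k / fact k * (deriv ^^ k) R a"
proof -
  have z_nonneg: "z \<notin> \<real>\<^sub>\<ge>\<^sub>0" using z by auto
  have nz: "sin (of_real pi * b) \<noteq> 0" if "b \<in> - \<int>" for b :: complex
    using that by (auto simp: sin_eq_0)
  have open_Compl_Ints: "open (- \<int> :: complex set)" by (simp add: open_Compl)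
  have "(deriv ^^ k) (lerch_reflection z 0) a = (-1) ^ k * fact k * lerch_reflection z k a"
    using a lerch_reflection_has_field_derivative[OF z_nonneg]
    by (intro higher_deriv_eq_fact_mult[OF open_Compl_Ints]) auto
  hence "lerch_reflection z k a = (-1) ^ k / fact k * (deriv ^^ k) (lerch_reflection z 0) a"
    by simp
  also have "(deriv ^^ k) (lerch_reflection z 0) a = (deriv ^^ k) (\<lambda>b. of_real pi * R b) a"
  proof (rule higher_deriv_cong_ev)
    have "lerch_reflection z 0 b = of_real pi * R b" if "b \<in> - \<int>" for b
      using lerch_reflection_0[OF z_nonneg, of b] exp_Ln_minus_over_sin[OF z nz, of b] that
      by (simp only: R_def Compl_iff simp_thms)
    thus "\<forall>\<^sub>F b in nhds a. lerch_reflection z 0 b = of_real pi * R b"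
      using eventually_nhds_in_open[OF open_Compl_Ints, of a] a by (auto elim!: eventually_mono)
  qed auto
  also have "\<dots> = of_real pi * (deriv ^^ k) R a"
  proof (rule higher_deriv_cmult)
    show "R holomorphic_on - \<int>"
      unfolding R_def cot_def using nz by (intro holomorphic_intros) auto
  qed (use a open_Compl_Ints in auto)
  finally show ?thesis by (simp only: mult_ac times_divide_eq_left times_divide_eq_right)
qed

theorem theorem2:
  fixes z a :: complex and n :: nat and \<phi> :: real
  assumes "0 < norm z" and "norm z < 1"
    and "- pi < Arg z" and "Arg z < pi"
    and "z \<notin> complex_of_real ` {0<..<1}"
    and "\<phi> = Arg (- Ln z)"
    and "n \<ge> 1"
    and "a \<notin> \<int>"
  shows "lerch_phi z n a + (-1) ^ n * inverse z * lerch_phi (inverse z) n (1 - a) =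
           of_real pi * (-1) ^ (n - 1) / fact (n - 1) *
           (deriv ^^ (n - 1))
             (\<lambda>b. exp (- b * Ln z) * (cot (of_real pi * b) - of_real (sgn \<phi>) * \<i>)) a"
proof -
  obtain k where n: "n = Suc k" using assms(7) by (cases n) auto
  have z: "z \<notin> \<real>" using assms(1,2,4,5) by (rule notin_Reals_of_Arg_less_pi)
  hence "z \<notin> \<real>\<^sub>\<ge>\<^sub>0" "inverse z \<notin> \<real>\<^sub>\<ge>\<^sub>0"
    by (auto simp: nonneg_Reals_inverse_iff)
  hence "z \<in> lerch_domain" "inverse z \<in> lerch_domain"
    by (auto intro: notin_nonneg_Reals_imp_lerch_domain)
  hence "lerch_phi z n a + (-1) ^ n * inverse z * lerch_phi (inverse z) n (1 - a) =
      lerch_reflection z k a"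
    using notin_Ints_imp_notin_nonpos_Ints[OF assms(8)]
    unfolding n lerch_reflection_def by (simp add: lerch_phi_eq_lerch_ext)
  also note lerch_reflection_eq_higher_deriv[OF z assms(8)]
  finally show ?thesis by (simp only: n assms(6) diff_Suc_1)
qed

end
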